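(* Let $(\Omega,\mathfrak{F},\mathbb{P})$ be a complete probability space with an ergodic measure-preserving flow $(\theta_t)_{t\in\mathbb{R}}$, $\omega\cdot t := \theta_t(\omega)$. Let $A\colon\Omega\to\mathbb{R}^{N\times N}$, $A=(a_{ij})$, belong to $L_1(\Omega,\mathfrak{F},\mathbb{P};\mathbb{R}^{N\times N})$, and assume that for each $\omega\in\Omega$ all off-diagonal entries of $A(\omega)$ are nonnegative. Let $\lambda$ be the top Lyapunov exponent of the random linear system $x' = A(\omega\cdot t)x$. Then \[ \lambda \ge \frac{1}{N}\int_{\Omega} \Bigl( \operatorname{tr} A(\omega) + 2\sum_{1\le j<k\le N}\sqrt{a_{jk}(\omega)\,a_{kj}(\omega)} \Bigr)\, d\mathbb{P}(\omega). \]
   Context: A measure-preserving flow is a $(\mathfrak{B}(\mathbb{R})\otimes\mathfrak{F},\mathfrak{F})$-measurable map $\theta\colon\mathbb{R}\times\Omega\to\Omega$ with $\theta_0=\mathrm{Id}$, $\theta_{s+t}=\theta_t\circ\theta_s$, and $\mathbb{P}(\theta_t(F))=\mathbb{P}(F)$ for all $t$ and $F\in\mathfrak{F}$; ergodic means every invariant $F\in\mathfrak{F}$ has probability $0$ or $1$. For each $\omega$ and $x_0\in\mathbb{R}^N$, $x(t;\omega,x_0)$ denotes the unique Carath\'eodory solution of $x'=A(\omega\cdot t)x$ with $x(0)=x_0$, and $U_\omega(t)x_0 := x(t;\omega,x_0)$. The top Lyapunov exponent is the real number $\lambda$ such that $\lim_{t\to\infty}\frac{1}{t}\ln\|U_\omega(t)\|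 = \lambda$ for $\mathbb{P}$-a.e. $\omega$ (it exists under the integrability assumption), where $\|\cdot\|$ is the operator norm induced by the Euclidean norm. *)

theory Defs
  imports "HOL-Analysis.Analysis" "HOL-Probability.Probability"
begin

definition mp_flow :: "'a measure \<Rightarrow> (real \<Rightarrow> 'a \<Rightarrow> 'a) \<Rightarrow> bool" where
  "mp_flow M \<theta> \<longleftrightarrow>
     (\<lambda>(t, \<omega>). \<theta> t \<omega>) \<in> (borel \<Otimes>\<^sub>M M) \<rightarrow>\<^sub>M M \<and>
     (\<forall>\<omega>\<in>space M. \<theta> 0 \<omega> = \<omega>) \<and>
     (\<forall>s t. \<forall>\<omega>\<in>space M. \<theta> (s + t) \<omega> = \<theta> t (\<theta> s \<omega>)) \<and>
     (\<forall>t. \<forall>F\<in>sets M. emeasure M (\<theta> t ` F) = emeasure M F)"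

definition ergodic_flow :: "'a measure \<Rightarrow> (real \<Rightarrow> 'a \<Rightarrow> 'a) \<Rightarrow> bool" where
  "ergodic_flow M \<theta> \<longleftrightarrow>
     (\<forall>F\<in>sets M. (\<forall>t. \<theta> t ` F = F) \<longrightarrow> measure M F = 0 \<or> measure M F = 1)"

definition carath_sol ::
  "(real \<Rightarrow> 'a \<Rightarrow> 'a) \<Rightarrow> ('a \<Rightarrow> real^'n^'n) \<Rightarrow> 'a \<Rightarrow> real^'n \<Rightarrow> (real \<Rightarrow> real^'n) \<Rightarrow> bool" where
  "carath_sol \<theta> A \<omega> x0 x \<longleftrightarrow>
     (\<forall>t. (\<lambda>s. A (\<theta> s \<omega>) *v x s) absolutely_integrable_on {min 0 t..max 0 t} \<and>
          x t = x0 + (if 0 \<le> t then integral {0..t} (\<lambda>s. A (\<theta> s \<omega>) *v x s)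
                      else - integral {t..0} (\<lambda>s. A (\<theta> s \<omega>) *v x s)))"

definition U_sol ::
  "(real \<Rightarrow> 'a \<Rightarrow> 'a) \<Rightarrow> ('a \<Rightarrow> real^'n^'n) \<Rightarrow> 'a \<Rightarrow> real \<Rightarrow> real^'n \<Rightarrow> real^'n" where
  "U_sol \<theta> A \<omega> t x0 = (THE x. carath_sol \<theta> A \<omega> x0 x) t"

definition top_lyapunov ::
  "'a measure \<Rightarrow> (real \<Rightarrow> 'a \<Rightarrow> 'a) \<Rightarrow> ('a \<Rightarrow> real^'n^'n) \<Rightarrow> real \<Rightarrow> bool" where
  "top_lyapunov M \<theta> A lam \<longleftrightarrow>
     (AE \<omega> in M. ((\<lambda>t. ln (onorm (U_sol \<theta> A \<omega> t)) / t) \<longlongrightarrow> lam) at_top)"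

end

theory Submission
  imports Defs
begin

text \<open>
  The solution \<open>x\<close> started at \<open>(1, \<dots>, 1)\<close> stays componentwise positive, and
  \<open>(\<Sum>i. ln (x i))' = \<Sum>i j. a i j * x j / x i\<close> almost everywhere. Pairing the terms \<open>(j, k)\<close>
  and \<open>(k, j)\<close> and using the AM-GM inequality bounds this from below by the integrand
  \<open>g = tr A + 2 * (\<Sum>j<k. sqrt (a j k * a k j))\<close>, so that \<open>N * ln \<parallel>x t\<parallel>\<close> is at least the integral of \<open>g\<close>
  along the orbit up to time \<open>t\<close>. Dividing by \<open>t\<close> and letting \<open>t\<close> tend to infinity, Fatou's lemma
  for \<open>(c - g)\<^sup>+\<close> and invariance of the measure give \<open>\<integral> g \<le> N * lam\<close>; since only this one
  inequality is needed, Birkhoff's theorem can be avoided.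
\<close>

section \<open>Chain rule for indefinite integrals\<close>

text \<open>The estimate is additive over adjacent intervals: cut \<open>{a..b}\<close> into n equal
  pieces shorter than \<delta> and telescope.\<close>

lemma abs_diff_le_of_local:
  fixes \<Phi> W :: "real \<Rightarrow> real"
  assumes "a \<le> b" "\<delta> > 0"
    and loc: "\<And>s t. a \<le> s \<Longrightarrow> s \<le> t \<Longrightarrow> t \<le> b \<Longrightarrow> t - s < \<delta> \<Longrightarrow> \<bar>\<Phi> t - \<Phi> s\<bar> \<le> W t - W s"
  shows "\<bar>\<Phi> b - \<Phi> a\<bar> \<le> W b - W a"
proof -
  obtain n :: nat where n: "real n > (b - a) / \<delta>" "n > 0"
    using reals_Archimedean2[of "max ((b - a) / \<delta>) 0"] by auto
  define p where "p k = a + real k * ((b - a) / real n)" for k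
  have step: "p (Suc k) - p k = (b - a) / n" for k
    by (simp add: p_def add_divide_distrib distrib_right)
  have small: "(b - a) / n < \<delta>"
    using n \<open>\<delta> > 0\<close> by (simp add: field_simps)
  have pn: "p n = b"
    using n by (simp add: p_def)
  have ge: "a \<le> p k" for k
    using \<open>a \<le> b\<close> by (simp add: p_def)
  have le: "p k \<le> b" if "k \<le> n" for k
  proof -
    have "real k * ((b - a) / real n) \<le> real n * ((b - a) / real n)"
      using that \<open>a \<le> b\<close> by (intro mult_right_mono) auto
    then show ?thesis using n by (simp add: p_def)
  qed
  have "k \<le> n \<Longrightarrow> \<bar>\<Phi> (p k) - \<Phi> a\<bar> \<le> W (p k) - W a" for k
  proof (induction k)
    case 0
    then show ?case by (simp add: p_def)
  next
    case (Suc k)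
    have "0 \<le> (b - a) / n"
      using \<open>a \<le> b\<close> by simp
    then have "\<bar>\<Phi> (p (Suc k)) - \<Phi> (p k)\<bar> \<le> W (p (Suc k)) - W (p k)"
      using step[of k] small by (intro loc ge le Suc.prems) linarith+
    then show ?case using Suc by linarith
  qed
  from this[of n] show ?thesis by (simp add: pn)
qed

text \<open>As an indefinite integral, \<open>u\<close> is only absolutely continuous, so the
  pointwise fundamental theorem of calculus does not apply directly. Instead the defect \<Phi>
  between \<phi>(u t) and the integral of \<phi>'(u) f is shown to have equal end values: on short
  intervals its increment is at most \<epsilon> times the integral of |f|, these bounds add up, and
  \<epsilon> is arbitrary.\<close>

lemma has_integral_chain_rule:
  fixes u f \<phi> \<phi>' :: "real \<Rightarrow> real"
  assumes ab: "a \<le> b" and f: "f absolutely_integrable_on {a..b}"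
    and u: "\<And>t. t \<in> {a..b} \<Longrightarrow> u t = u a + integral {a..t} f"
    and deriv: "\<And>t. t \<in> {a..b} \<Longrightarrow> (\<phi> has_real_derivative \<phi>' (u t)) (at (u t))"
    and cont: "continuous_on (u ` {a..b}) \<phi>'"
  shows "((\<lambda>t. \<phi>' (u t) * f t) has_integral \<phi> (u b) - \<phi> (u a)) {a..b}"
proof -
  have fi: "f integrable_on {a..b}" "(\<lambda>t. \<bar>f t\<bar>) integrable_on {a..b}"
    using f by (auto simp: absolutely_integrable_on_def)
  have fis: "f integrable_on {s..t}" "(\<lambda>t. \<bar>f t\<bar>) integrable_on {s..t}" if "a \<le> s" "t \<le> b" for s t
    using integrable_on_subinterval[OF fi(1), of s t] integrable_on_subinterval[OF fi(2), of s t] that by auto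
  have "continuous_on {a..b} (\<lambda>t. u a + integral {a..t} f)"
    by (intro continuous_intros indefinite_integral_continuous_1 fi)
  then have cu: "continuous_on {a..b} u"
    by (rule continuous_on_eq) (rule u[symmetric])
  define h where "h t = \<phi>' (u t)" for t
  have ch: "continuous_on {a..b} h"
    unfolding h_def by (rule continuous_on_compose2[OF cont cu]) auto
  have hf: "(\<lambda>t. h t * f t) absolutely_integrable_on {a..b}"
    by (intro absolutely_integrable_bounded_measurable_product_real f
        continuous_imp_measurable_on_sets_lebesgue ch compact_imp_bounded compact_continuous_image)
      auto
  then have hfi: "(\<lambda>t. h t * f t) integrable_on {a..b}"
    by (simp add: absolutely_integrable_on_def)
  define \<Phi> where "\<Phi> t = \<phi> (u t) - integral {a..t} (\<lambda>t. h t * f t)" for t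
  define V where "V t = integral {a..t} (\<lambda>t. \<bar>f t\<bar>)" for t
  have split: "integral {a..t} F - integral {a..s} F = integral {s..t} F"
    if "a \<le> s" "s \<le> t" "t \<le> b" "F integrable_on {a..b}" for s t and F :: "real \<Rightarrow> real"
    using Henstock_Kurzweil_Integration.integral_combine[of a s t F] integrable_on_subinterval[OF that(4), of a t] that by auto
  have ud: "u t - u s = integral {s..t} f" if "a \<le> s" "s \<le> t" "t \<le> b" for s t
  proof -
    have "u t = u a + integral {a..t} f" "u s = u a + integral {a..s} f"
      using that by (intro u; simp)+
    then show ?thesis
      using split[OF that fi(1)] by linarith
  qed
  \<comment> \<open>The mean value theorem is applied to \<phi> between \<open>u s\<close> and
    \<open>u t\<close>. The image of \<open>{s..t}\<close> under \<open>u\<close> is connected, so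
    the intermediate value is \<open>u \<xi>\<close> for some \<xi> in the same short interval,
    where \<open>h \<xi>\<close> is close to every \<open>h r\<close>.\<close>
  have mvt: "\<exists>\<xi>\<in>{s..t}. \<phi> (u t) - \<phi> (u s) = h \<xi> * (u t - u s)" if st: "a \<le> s" "s \<le> t" "t \<le> b" for s t
  proof -
    have cst: "continuous_on {s..t} u"
      by (rule continuous_on_subset[OF cu]) (use st in auto)
    have conn: "connected (u ` {s..t})"
      by (intro connected_continuous_image cst) auto
    have mem: "u s \<in> u ` {s..t}" "u t \<in> u ` {s..t}"
      using st by auto
    have d: "(\<phi> has_real_derivative \<phi>' z) (at z)" if "z \<in> u ` {s..t}" for z
      using that deriv st by auto
    consider "u s < u t" | "u t < u s" | "u s = u t" by linarith
    then show ?thesis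
    proof cases
      case 1
      have sub: "{u s..u t} \<subseteq> u ` {s..t}"
        using conn mem by (rule connected_contains_Icc)
      have "\<exists>z>u s. z < u t \<and> \<phi> (u t) - \<phi> (u s) = (u t - u s) * \<phi>' z"
        using 1 sub by (intro MVT2 d) auto
      then obtain z where z: "z > u s" "z < u t" "\<phi> (u t) - \<phi> (u s) = (u t - u s) * \<phi>' z" by blast
      with sub obtain \<xi> where "\<xi> \<in> {s..t}" "z = u \<xi>" by (metis atLeastAtMost_iff imageE less_imp_le subsetD)
      with z show ?thesis by (auto simp: h_def mult.commute)
    next
      case 2
      have sub: "{u t..u s} \<subseteq> u ` {s..t}"
        using conn mem(2,1) by (rule connected_contains_Icc)
      have "\<exists>z>u t. z < u s \<and> \<phi> (u s) - \<phi> (u t) = (u s - u t) * \<phi>' z"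
        using 2 sub by (intro MVT2 d) auto
      then obtain z where z: "z > u t" "z < u s" "\<phi> (u s) - \<phi> (u t) = (u s - u t) * \<phi>' z" by blast
      with sub obtain \<xi> where \<xi>: "\<xi> \<in> {s..t}" "z = u \<xi>" by (metis atLeastAtMost_iff imageE less_imp_le subsetD)
      have "\<phi> (u t) - \<phi> (u s) = \<phi>' z * (u t - u s)"
        using z(3) by (simp add: algebra_simps)
      with \<xi> show ?thesis by (auto simp: h_def)
    next
      case 3
      then show ?thesis using st by auto
    qed
  qed
  have bound: "\<bar>\<Phi> b - \<Phi> a\<bar> \<le> \<epsilon> * V b" if "\<epsilon> > 0" for \<epsilon>
  proof -
    have "uniformly_continuous_on {a..b} h"
      by (intro compact_uniformly_continuous ch) auto
    then obtain \<delta> where \<delta>: "\<delta> > 0"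
      "\<And>x y. x \<in> {a..b} \<Longrightarrow> y \<in> {a..b} \<Longrightarrow> \<bar>x - y\<bar> < \<delta> \<Longrightarrow> \<bar>h x - h y\<bar> < \<epsilon>"
      using \<open>\<epsilon> > 0\<close> unfolding uniformly_continuous_on_def dist_real_def by (metis abs_minus_commute)
    have "\<bar>\<Phi> b - \<Phi> a\<bar> \<le> (\<lambda>t. \<epsilon> * V t) b - (\<lambda>t. \<epsilon> * V t) a"
    proof (rule abs_diff_le_of_local[OF ab \<delta>(1)])
      fix s t assume st: "a \<le> s" "s \<le> t" "t \<le> b" "t - s < \<delta>"
      obtain \<xi> where \<xi>: "\<xi> \<in> {s..t}" "\<phi> (u t) - \<phi> (u s) = h \<xi> * (u t - u s)"
        using mvt[OF st(1-3)] by blast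
      have i1: "(\<lambda>r. h r * f r) integrable_on {s..t}"
        by (rule integrable_on_subinterval[OF hfi]) (use st in auto)
      have "\<Phi> t - \<Phi> s = h \<xi> * integral {s..t} f - integral {s..t} (\<lambda>r. h r * f r)"
        using \<xi>(2) split[OF st(1-3) hfi] ud[OF st(1-3)] by (simp add: \<Phi>_def)
      also have "\<dots> = integral {s..t} (\<lambda>r. h \<xi> * f r - h r * f r)"
        using fis[of s t] st i1 by (subst integral_diff) (auto intro!: integrable_on_mult_right)
      finally have eq: "\<Phi> t - \<Phi> s = integral {s..t} (\<lambda>r. h \<xi> * f r - h r * f r)" .
      have "norm (integral {s..t} (\<lambda>r. h \<xi> * f r - h r * f r)) \<le> integral {s..t} (\<lambda>r. \<epsilon> * \<bar>f r\<bar>)"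
      proof (rule Henstock_Kurzweil_Integration.integral_norm_bound_integral)
        show "(\<lambda>r. h \<xi> * f r - h r * f r) integrable_on {s..t}"
          using fis[of s t] st i1 by (intro integrable_diff) (auto intro!: integrable_on_mult_right)
        show "(\<lambda>r. \<epsilon> * \<bar>f r\<bar>) integrable_on {s..t}"
          using fis[of s t] st by (intro integrable_on_mult_right) auto
        fix r assume r: "r \<in> {s..t}"
        have "\<bar>h \<xi> - h r\<bar> < \<epsilon>"
          using r \<xi>(1) st by (intro \<delta>(2)) auto
        then have "\<bar>h \<xi> - h r\<bar> * \<bar>f r\<bar> \<le> \<epsilon> * \<bar>f r\<bar>"
          by (intro mult_right_mono) auto
        then show "norm (h \<xi> * f r - h r * f r) \<le> \<epsilon> * \<bar>f r\<bar>"
          by (simp add: abs_mult[symmetric] left_diff_distrib)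
      qed
      also have "\<dots> = \<epsilon> * V t - \<epsilon> * V s"
        using split[OF st(1-3) fi(2)] by (simp add: V_def right_diff_distrib[symmetric])
      finally show "\<bar>\<Phi> t - \<Phi> s\<bar> \<le> \<epsilon> * V t - \<epsilon> * V s"
        by (simp add: eq)
    qed
    then show ?thesis by (simp add: V_def)
  qed
  have "V b \<ge> 0"
    unfolding V_def by (rule integral_nonneg[OF fi(2)]) simp
  have "\<bar>\<Phi> b - \<Phi> a\<bar> \<le> e" if "e > 0" for e
  proof -
    \<comment> \<open>The summand 1 keeps the denominator positive when \<open>V b\<close> is
      0.\<close>
    have "\<bar>\<Phi> b - \<Phi> a\<bar> \<le> e / (V b + 1) * V b"
      using that \<open>V b \<ge> 0\<close> by (intro bound) auto
    also have "\<dots> \<le> e"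
      using that \<open>V b \<ge> 0\<close> by (simp add: field_simps)
    finally show ?thesis .
  qed
  then have "\<Phi> b = \<Phi> a"
    using dense_ge[of 0 "\<bar>\<Phi> b - \<Phi> a\<bar>"] by auto
  then have "integral {a..b} (\<lambda>t. h t * f t) = \<phi> (u b) - \<phi> (u a)"
    by (simp add: \<Phi>_def)
  with hfi show ?thesis
    unfolding h_def by (metis integrable_integral)
qed

section \<open>Linear equations with locally integrable coefficients\<close>

text \<open>The norm of the type \<open>real^'n^'m\<close> is the Frobenius norm, the L2 norm of the
  row norms, so Cauchy-Schwarz in each row suffices.\<close>

lemma norm_matrix_vector_mult_le:
  fixes A :: "real^'n^'m"
  shows "norm (A *v x) \<le> norm A * norm x"
proof -
  have "norm (A *v x) = L2_set (\<lambda>i. norm ((A *v x) $ i)) UNIV"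
    by (simp add: norm_vec_def)
  also have "\<dots> \<le> L2_set (\<lambda>i. norm (A $ i) * norm x) UNIV"
    by (intro L2_set_mono) (auto simp: matrix_vector_mul_component Cauchy_Schwarz_ineq2)
  also have "\<dots> = norm A * norm x"
    by (simp add: L2_set_left_distrib norm_vec_def)
  finally show ?thesis .
qed

text \<open>The vector comes first because the product rule for absolute integrability takes the
  bounded factor first and the integrable one second.\<close>

lemma bilinear_matrix_vector_mult: "bilinear (\<lambda>x (A::real^'n^'m). A *v x)"
  unfolding bilinear_def
  by (auto intro!: linearI simp: matrix_vector_right_distrib matrix_vector_mult_add_rdistrib
      matrix_vector_mult_scaleR scaleR_matrix_vector_assoc)

lemma absolutely_integrable_matrix_vector_mult:
  fixes B :: "real \<Rightarrow> real^'n^'m"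
  assumes "B absolutely_integrable_on {a..b}" "continuous_on {a..b} x"
  shows "(\<lambda>s. B s *v x s) absolutely_integrable_on {a..b}"
  by (rule absolutely_integrable_bounded_measurable_product[OF bilinear_matrix_vector_mult])
    (use assms in \<open>auto intro!: continuous_imp_measurable_on_sets_lebesgue compact_imp_bounded
      compact_continuous_image\<close>)

text \<open>\<open>T\<close> is not fixed, so the assumption is quantified over all
  \<open>T\<close>: the coefficients are locally integrable on the half line.\<close>

locale linear_ode =
  fixes B :: "real \<Rightarrow> real^'n^'n"
  assumes B: "B absolutely_integrable_on {0..T}"
begin

text \<open>Caratheodory solutions in integral form on the half line. Values at negative times are
  unconstrained, so the backward equation can be treated separately as a reflected problem.\<close>

definition solution :: "real^'n \<Rightarrow> (real \<Rightarrow> real^'n) \<Rightarrow> bool" where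
  "solution x0 x \<longleftrightarrow> (\<forall>t\<ge>0. (\<lambda>s. B s *v x s) absolutely_integrable_on {0..t} \<and>
     x t = x0 + integral {0..t} (\<lambda>s. B s *v x s))"

definition norm_int :: "real \<Rightarrow> real" where
  "norm_int t = integral {0..t} (\<lambda>s. norm (B s))"

lemma norm_B_integrable: "(\<lambda>s. norm (B s)) integrable_on {0..t}"
  using B by (simp add: absolutely_integrable_on_def)

lemma norm_int_nonneg: "norm_int t \<ge> 0"
  unfolding norm_int_def by (rule integral_nonneg[OF norm_B_integrable]) simp

lemma continuous_on_norm_int: "continuous_on {0..t} norm_int"
  unfolding norm_int_def by (rule indefinite_integral_continuous_1[OF norm_B_integrable])

section \<open>Uniqueness and existence by an exponentially weighted norm\<close>

text \<open>The weight \<open>exp (2 * norm_int s)\<close> has derivative twice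
  \<open>norm (B s)\<close> times itself almost everywhere; this 2 is the source of the factor 1/2
  in the estimates below.\<close>

lemma weight_has_integral:
  assumes "t \<ge> 0"
  shows "((\<lambda>s. norm (B s) * exp (2 * norm_int s)) has_integral (exp (2 * norm_int t) - 1) / 2) {0..t}"
proof -
  have "((\<lambda>s. exp (2 * norm_int s) * norm (B s)) has_integral exp (2 * norm_int t) / 2 - exp (2 * norm_int 0) / 2) {0..t}"
  proof (rule has_integral_chain_rule[where \<phi> = "\<lambda>y. exp (2 * y) / 2" and \<phi>' = "\<lambda>y. exp (2 * y)"])
    show "(\<lambda>s. norm (B s)) absolutely_integrable_on {0..t}"
      using B[of t] by (simp add: absolutely_integrable_on_def)
  qed (auto simp: assms norm_int_def intro!: derivative_eq_intros continuous_intros)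
  then show ?thesis by (simp add: norm_int_def mult.commute diff_divide_distrib)
qed

text \<open>Integrating the weight against \<open>norm (B s)\<close> halves it, up to a negative
  term that is dropped. Uniqueness, convergence of the iterates and the limit equation all rest on
  this one halving.\<close>

lemma norm_integral_weighted_le:
  assumes t: "t \<ge> 0" and x: "continuous_on {0..t} x" and C: "C \<ge> 0"
    and bd: "\<And>s. s \<in> {0..t} \<Longrightarrow> norm (x s) \<le> C * exp (2 * norm_int s)"
  shows "norm (integral {0..t} (\<lambda>s. B s *v x s)) \<le> C / 2 * exp (2 * norm_int t)"
proof -
  have "norm (integral {0..t} (\<lambda>s. B s *v x s)) \<le> integral {0..t} (\<lambda>s. C * (norm (B s) * exp (2 * norm_int s)))"
  proof (rule Henstock_Kurzweil_Integration.integral_norm_bound_integral)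
    show "(\<lambda>s. B s *v x s) integrable_on {0..t}"
      using absolutely_integrable_matrix_vector_mult[OF B x] by (simp add: absolutely_integrable_on_def)
    show "(\<lambda>s. C * (norm (B s) * exp (2 * norm_int s))) integrable_on {0..t}"
      using has_integral_mult_right[OF weight_has_integral[OF t], of C] by (rule has_integral_integrable)
    fix s assume s: "s \<in> {0..t}"
    have "norm (B s *v x s) \<le> norm (B s) * norm (x s)"
      by (rule norm_matrix_vector_mult_le)
    also have "\<dots> \<le> norm (B s) * (C * exp (2 * norm_int s))"
      by (intro mult_left_mono bd s) auto
    finally show "norm (B s *v x s) \<le> C * (norm (B s) * exp (2 * norm_int s))"
      by (simp add: mult_ac)
  qed
  also have "\<dots> = C * ((exp (2 * norm_int t) - 1) / 2)"
    using weight_has_integral[OF t] by (simp add: integral_unique)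
  also have "\<dots> \<le> C / 2 * exp (2 * norm_int t)"
    using C by (simp add: field_simps)
  finally show ?thesis .
qed

lemma continuous_on_solution:
  assumes "solution x0 x"
  shows "continuous_on {0..t} x"
proof (cases "t \<ge> 0")
  case True
  have "(\<lambda>s. B s *v x s) integrable_on {0..t}"
    using assms True by (auto simp: solution_def absolutely_integrable_on_def)
  then have "continuous_on {0..t} (\<lambda>r. x0 + integral {0..r} (\<lambda>s. B s *v x s))"
    by (intro continuous_intros indefinite_integral_continuous_1)
  then show ?thesis
    by (rule continuous_on_eq) (use assms in \<open>auto simp: solution_def\<close>)
qed auto

text \<open>The difference of two solutions solves the equation with initial value 0. If its
  weighted norm has maximum C on \<open>{0..t}\<close>, attained at r, the halving estimate at r
  gives C \<le> C / 2, hence C \<le> 0.\<close>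

lemma solution_unique:
  assumes x: "solution x0 x" and y: "solution x0 y" and t: "t \<ge> 0"
  shows "x t = y t"
proof -
  note cx = continuous_on_solution[OF x] and cy = continuous_on_solution[OF y]
  define d where "d s = x s - y s" for s
  have cd: "continuous_on {0..r} d" for r
    unfolding d_def by (intro continuous_intros cx cy)
  have d_eq: "d r = integral {0..r} (\<lambda>s. B s *v d s)" if "r \<ge> 0" for r
  proof -
    have "d r = integral {0..r} (\<lambda>s. B s *v x s) - integral {0..r} (\<lambda>s. B s *v y s)"
      using x y that by (simp add: solution_def d_def)
    also have "\<dots> = integral {0..r} (\<lambda>s. B s *v x s - B s *v y s)"
      using x y that by (subst integral_diff) (auto simp: solution_def absolutely_integrable_on_def)
    finally show ?thesis by (simp add: d_def matrix_vector_mult_diff_distrib)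
  qed
  have "continuous_on {0..t} (\<lambda>s. norm (d s) * exp (- 2 * norm_int s))"
    by (intro continuous_intros cd continuous_on_norm_int)
  from continuous_attains_sup[OF _ _ this] t obtain r where r: "r \<in> {0..t}"
    and max: "\<And>s. s \<in> {0..t} \<Longrightarrow> norm (d s) * exp (- 2 * norm_int s) \<le> norm (d r) * exp (- 2 * norm_int r)"
    by auto
  define C where "C = norm (d r) * exp (- 2 * norm_int r)"
  have C_nonneg: "C \<ge> 0" by (simp add: C_def)
  have bd: "norm (d s) \<le> C * exp (2 * norm_int s)" if "s \<in> {0..t}" for s
    using max[OF that] by (simp add: C_def exp_minus field_simps)
  have "norm (d r) \<le> C / 2 * exp (2 * norm_int r)"
    by (subst d_eq) (use r bd C_nonneg in \<open>auto intro!: norm_integral_weighted_le cd simp del: times_divide_eq_left\<close>)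
  then have "C \<le> C / 2"
    by (simp add: C_def exp_minus field_simps)
  then have "C \<le> 0" by simp
  then have "norm (d t) \<le> 0"
    using bd[of t] t mult_nonpos_nonneg[of C "exp (2 * norm_int t)"] by (simp del: norm_le_zero_iff)
  then show ?thesis by (simp add: d_def)
qed

text \<open>In the norm weighted by \<open>exp (2 * norm_int t)\<close> the Picard map is a contraction
  with factor \<open>1/2\<close>, on every interval at once.\<close>

primrec picard :: "real^'n \<Rightarrow> nat \<Rightarrow> real \<Rightarrow> real^'n" where
  "picard x0 0 = (\<lambda>t. 0)"
| "picard x0 (Suc k) = (\<lambda>t. x0 + integral {0..t} (\<lambda>s. B s *v picard x0 k s))"

lemma continuous_on_picard: "continuous_on {0..t} (picard x0 k)"
proof (induction k arbitrary: t)
  case (Suc k)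
  show ?case
    using absolutely_integrable_matrix_vector_mult[OF B Suc]
    by (auto intro!: continuous_intros indefinite_integral_continuous_1 simp: absolutely_integrable_on_def)
qed simp

text \<open>Since the iteration starts at 0, the first increment is \<open>x0\<close> itself. Each
  later one is the integral of \<open>B\<close> applied to its predecessor, which halves the
  weighted bound.\<close>

lemma picard_step_le:
  "t \<ge> 0 \<Longrightarrow> norm (picard x0 (Suc k) t - picard x0 k t) \<le> norm x0 * (1/2) ^ k * exp (2 * norm_int t)"
proof (induction k arbitrary: t)
  case 0
  show ?case
    using mult_left_mono[of 1 "exp (2 * norm_int t)" "norm x0"] norm_int_nonneg[of t] by simp
next
  case (Suc k)
  have i: "(\<lambda>s. B s *v picard x0 j s) integrable_on {0..t}" for j
    using absolutely_integrable_matrix_vector_mult[OF B continuous_on_picard]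
    by (simp add: absolutely_integrable_on_def)
  have "picard x0 (Suc (Suc k)) t - picard x0 (Suc k) t =
      integral {0..t} (\<lambda>s. B s *v picard x0 (Suc k) s) - integral {0..t} (\<lambda>s. B s *v picard x0 k s)"
    by (simp only: picard.simps) simp
  also have "\<dots> = integral {0..t} (\<lambda>s. B s *v (picard x0 (Suc k) s - picard x0 k s))"
    using i by (subst integral_diff[symmetric]) (auto simp del: picard.simps simp: matrix_vector_mult_diff_distrib)
  also have "norm \<dots> \<le> norm x0 * (1/2) ^ k / 2 * exp (2 * norm_int t)"
    using Suc by (intro norm_integral_weighted_le continuous_intros continuous_on_picard) auto
  finally show ?case by simp
qed

text \<open>The iterates are partial sums of their increments, which a geometric series dominates
  uniformly on every \<open>{0..T}\<close>. The locally uniform limit is continuous, and the halving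
  estimate carries the integral equation over to it.\<close>

lemma solution_exists: "\<exists>x. solution x0 x"
proof -
  define D where "D k t = picard x0 (Suc k) t - picard x0 k t" for k t
  have sumD: "(\<Sum>k<n. D k t) = picard x0 n t" for n t
    unfolding D_def by (subst sum_lessThan_telescope) simp
  define x where "x t = suminf (\<lambda>k. D k t)" for t
  have ul: "uniform_limit {0..T} (picard x0) x sequentially" for T
  proof -
    obtain c where c: "\<And>t. t \<in> {0..T} \<Longrightarrow> exp (2 * norm_int t) \<le> c"
    proof (cases "T \<ge> 0")
      case True
      have "continuous_on {0..T} (\<lambda>t. exp (2 * norm_int t))"
        by (intro continuous_intros continuous_on_norm_int)
      from continuous_attains_sup[OF _ _ this] True
      obtain r where "\<forall>t\<in>{0..T}. exp (2 * norm_int t) \<le> exp (2 * norm_int r)"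
        by (metis atLeastatMost_empty_iff compact_Icc)
      then show ?thesis by (intro that) blast
    qed (use that in auto)
    have "uniform_limit {0..T} (\<lambda>n t. \<Sum>k<n. D k t) (\<lambda>t. suminf (\<lambda>k. D k t)) sequentially"
    proof (rule Weierstrass_m_test)
      show "summable (\<lambda>k. norm x0 * c * (1/2) ^ k)"
        by (intro summable_mult summable_geometric) simp
      fix k t assume t: "t \<in> {0..T}"
      have "norm (D k t) \<le> norm x0 * (1/2) ^ k * exp (2 * norm_int t)"
        unfolding D_def using t by (intro picard_step_le) auto
      also have "\<dots> \<le> norm x0 * (1/2) ^ k * c"
        by (intro mult_left_mono c t) auto
      finally show "norm (D k t) \<le> norm x0 * c * (1/2) ^ k" by (simp add: mult_ac)
    qed
    then show ?thesis by (simp add: sumD x_def[symmetric])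
  qed
  have cx: "continuous_on {0..t} x" for t
    by (rule uniform_limit_theorem[OF _ ul]) (auto simp: continuous_on_picard)
  have ai: "(\<lambda>s. B s *v x s) absolutely_integrable_on {0..t}" for t
    by (rule absolutely_integrable_matrix_vector_mult[OF B cx])
  have "x t = x0 + integral {0..t} (\<lambda>s. B s *v x s)" if t: "t \<ge> 0" for t
  proof -
    have "(\<lambda>n. picard x0 (Suc n) t - (x0 + integral {0..t} (\<lambda>s. B s *v x s))) \<longlonglongrightarrow> 0"
    proof (rule LIMSEQ_I)
      fix e :: real assume "e > 0"
      \<comment> \<open>With this choice the weighted estimate at time t comes out as e / 2. The
        uniform bound e' is also a weighted bound because the weight is at least 1.\<close>
      define e' where "e' = e / exp (2 * norm_int t)"
      have "e' > 0" using \<open>e > 0\<close> by (simp add: e'_def)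
      from uniform_limitD[OF ul[of t] this] obtain n0
        where n0: "\<forall>n\<ge>n0. \<forall>s\<in>{0..t}. norm (picard x0 n s - x s) < e'"
        unfolding eventually_sequentially dist_norm by blast
      have "norm (picard x0 (Suc n) t - (x0 + integral {0..t} (\<lambda>s. B s *v x s)) - 0) < e" if "n \<ge> n0" for n
      proof -
        have i: "(\<lambda>s. B s *v picard x0 n s) integrable_on {0..t}"
          using absolutely_integrable_matrix_vector_mult[OF B continuous_on_picard]
          by (simp add: absolutely_integrable_on_def)
        have "picard x0 (Suc n) t - (x0 + integral {0..t} (\<lambda>s. B s *v x s)) - 0 =
            integral {0..t} (\<lambda>s. B s *v (picard x0 n s - x s))"
          using i ai[of t] by (simp add: matrix_vector_mult_diff_distrib integral_diff absolutely_integrable_on_def)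
        also have "norm \<dots> \<le> e' / 2 * exp (2 * norm_int t)"
        proof (rule norm_integral_weighted_le[OF t])
          show "continuous_on {0..t} (\<lambda>s. picard x0 n s - x s)"
            by (intro continuous_intros continuous_on_picard cx)
          show "0 \<le> e'" using \<open>e' > 0\<close> by simp
          fix s assume s: "s \<in> {0..t}"
          have "e' * 1 \<le> e' * exp (2 * norm_int s)"
            using \<open>e' > 0\<close> norm_int_nonneg[of s] by (intro mult_left_mono) auto
          then show "norm (picard x0 n s - x s) \<le> e' * exp (2 * norm_int s)"
            using n0 \<open>n \<ge> n0\<close> s by force
        qed
        also have "\<dots> < e" using \<open>e > 0\<close> by (simp add: e'_def)
        finally show ?thesis .
      qed
      then show "\<exists>n0. \<forall>n\<ge>n0. norm (picard x0 (Suc n) t - (x0 + integral {0..t} (\<lambda>s. B s *v x s)) - 0) < e"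
        by blast
    qed
    then have 1: "(\<lambda>n. picard x0 (Suc n) t) \<longlonglongrightarrow> x0 + integral {0..t} (\<lambda>s. B s *v x s)"
      by (simp only: LIM_zero_iff)
    have "(\<lambda>n. picard x0 n t) \<longlonglongrightarrow> x t"
      by (rule tendsto_uniform_limitI[OF ul[of t]]) (use t in auto)
    then have "(\<lambda>n. picard x0 (Suc n) t) \<longlonglongrightarrow> x t"
      by (rule LIMSEQ_Suc)
    with 1 show ?thesis by (rule LIMSEQ_unique[symmetric])
  qed
  with ai show ?thesis unfolding solution_def by blast
qed

section \<open>Logarithms of components, positivity and superposition\<close>

lemma solution_component:
  assumes x: "solution x0 x" and t: "t \<ge> 0"
  shows "(\<lambda>s. (B s *v x s) $ i) absolutely_integrable_on {0..t}"
    and "x t $ i = x0 $ i + integral {0..t} (\<lambda>s. (B s *v x s) $ i)"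
proof -
  have ai: "(\<lambda>s. B s *v x s) absolutely_integrable_on {0..t}" and eq: "x t = x0 + integral {0..t} (\<lambda>s. B s *v x s)"
    using x t by (auto simp: solution_def)
  from absolutely_integrable_component[OF ai, of "axis i 1"]
  show "(\<lambda>s. (B s *v x s) $ i) absolutely_integrable_on {0..t}"
    by (simp add: inner_axis)
  have "(\<lambda>s. B s *v x s) integrable_on {0..t}" using ai by (simp add: absolutely_integrable_on_def)
  from integral_component_eq[OF this, of "axis i 1"]
  show "x t $ i = x0 $ i + integral {0..t} (\<lambda>s. (B s *v x s) $ i)"
    by (simp add: inner_axis eq)
qed

lemma ln_component_has_integral:
  assumes x: "solution x0 x" and t: "t \<ge> 0" and pos: "\<And>s. s \<in> {0..t} \<Longrightarrow> x s $ i > 0"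
  shows "((\<lambda>s. inverse (x s $ i) * (B s *v x s) $ i) has_integral ln (x t $ i) - ln (x 0 $ i)) {0..t}"
proof (rule has_integral_chain_rule[where \<phi> = ln and \<phi>' = inverse and u = "\<lambda>s. x s $ i"])
  show "(\<lambda>s. (B s *v x s) $ i) absolutely_integrable_on {0..t}"
    using solution_component(1)[OF x t] .
  fix s assume s: "s \<in> {0..t}"
  then show "x s $ i = x 0 $ i + integral {0..s} (\<lambda>s. (B s *v x s) $ i)"
    using solution_component(2)[OF x, of s] solution_component(2)[OF x, of 0] by simp
  show "(ln has_real_derivative inverse (x s $ i)) (at (x s $ i))"
    using pos[OF s] by (rule DERIV_ln)
next
  show "continuous_on ((\<lambda>s. x s $ i) ` {0..t}) inverse"
    by (intro continuous_intros) (use pos in force)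
qed (rule t)

text \<open>Let T be the first time at which some component, say the j-th, is not positive. Before T
  all components are positive, so the off-diagonal terms only help and the logarithmic derivative of
  component j is at least \<open>B s $ j $ j\<close>, hence at least \<open>- norm (B s)\<close>.
  This keeps component j above a positive constant before T and, by continuity, at T.\<close>

lemma solution_positive:
  assumes x: "solution x0 x" and x0: "\<And>i. x0 $ i > 0"
    and offdiag: "\<And>s j k. s \<ge> 0 \<Longrightarrow> j \<noteq> k \<Longrightarrow> B s $ j $ k \<ge> 0"
    and t: "t \<ge> 0"
  shows "x t $ i > 0"
proof (rule ccontr)
  assume neg: "\<not> x t $ i > 0"
  have cx: "continuous_on {0..t} (\<lambda>s. x s $ j)" for j
    by (intro continuous_intros continuous_on_solution[OF x])
  define S where "S = (\<Union>j. {s \<in> {0..t}. x s $ j \<le> 0})"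
  have "closed S"
    unfolding S_def by (intro closed_UN finite_UNIV ballI continuous_closed_preimage_constant
      continuous_on_closed_Collect_le cx continuous_intros) auto
  moreover have "S \<subseteq> {0..t}" by (auto simp: S_def)
  ultimately have "compact S"
    by (meson bounded_closed_interval bounded_subset compact_eq_bounded_closed)
  moreover have "S \<noteq> {}" using neg t unfolding S_def by (simp add: not_less) (metis order_refl)
  ultimately obtain T where T: "T \<in> S" and least: "\<And>s. s \<in> S \<Longrightarrow> T \<le> s"
    using compact_attains_inf[of S] by metis
  obtain j where Tj: "T \<in> {0..t}" "x T $ j \<le> 0" using T by (auto simp: S_def)
  have x00: "x 0 = x0" using x by (auto simp: solution_def)
  have "T \<noteq> 0" using Tj x0[of j] x00 by auto
  with Tj have "T > 0" by auto
  have before: "x s $ k > 0" if "s \<in> {0..<T}" for s k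
  proof (rule ccontr)
    assume "\<not> x s $ k > 0"
    then have "s \<in> S" using that Tj by (auto simp: S_def not_less)
    from least[OF this] that show False by auto
  qed
  \<comment> \<open>The bound has \<open>norm_int T\<close> in place of \<open>norm_int s\<close>,
    so it does not depend on s and survives the limit from the left at T. The interval is half-open
    because the logarithm needs positivity.\<close>
  have lower: "ln (x s $ j) \<ge> ln (x0 $ j) - norm_int T" if s: "s \<in> {0..<T}" for s
  proof -
    have up: "((\<lambda>r. inverse (x r $ j) * (B r *v x r) $ j) has_integral ln (x s $ j) - ln (x 0 $ j)) {0..s}"
      using s before by (intro ln_component_has_integral[OF x]) auto
    have lo: "((\<lambda>r. - norm (B r)) has_integral - norm_int s) {0..s}"
      unfolding norm_int_def using norm_B_integrable[of s] by (intro has_integral_neg) auto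
    have "- norm_int s \<le> ln (x s $ j) - ln (x 0 $ j)"
    proof (rule has_integral_le[OF lo up])
      fix r assume r: "r \<in> {0..s}"
      have rj: "x r $ k > 0" for k using before r s by auto
      have "(\<Sum>k\<in>UNIV. B r $ j $ k * x r $ k) = B r $ j $ j * x r $ j + (\<Sum>k\<in>UNIV - {j}. B r $ j $ k * x r $ k)"
        by (rule sum.remove) auto
      moreover have "(\<Sum>k\<in>UNIV - {j}. B r $ j $ k * x r $ k) \<ge> 0"
        using offdiag[of r j] r rj by (intro sum_nonneg mult_nonneg_nonneg) (auto simp: less_imp_le)
      ultimately have "B r $ j $ j * x r $ j \<le> (B r *v x r) $ j"
        by (simp add: matrix_vector_mult_def)
      then have "B r $ j $ j \<le> inverse (x r $ j) * (B r *v x r) $ j"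
        using rj[of j] by (simp add: field_simps)
      moreover have "\<bar>B r $ j $ j\<bar> \<le> norm (B r)"
        by (rule order_trans[OF component_le_norm_cart Finite_Cartesian_Product.norm_nth_le])
      ultimately show "- norm (B r) \<le> inverse (x r $ j) * (B r *v x r) $ j" by linarith
    qed
    moreover have "norm_int s \<le> norm_int T"
      unfolding norm_int_def using s by (intro integral_subset_le norm_B_integrable) auto
    ultimately show ?thesis by (simp add: x00)
  qed
  have "x T $ j \<ge> exp (ln (x0 $ j) - norm_int T)"
  proof (rule tendsto_lowerbound)
    have "continuous_on {0..T} (\<lambda>s. x s $ j)"
      using cx by (rule continuous_on_subset) (use Tj in auto)
    from continuous_on_Icc_at_leftD[OF this \<open>T > 0\<close>]
    show "((\<lambda>s. x s $ j) \<longlongrightarrow> x T $ j) (at_left T)" .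
    show "\<forall>\<^sub>F s in at_left T. exp (ln (x0 $ j) - norm_int T) \<le> x s $ j"
      using eventually_at_left_real[OF \<open>T > 0\<close>]
    proof eventually_elim
      case (elim s)
      then have "s \<in> {0..<T}" by auto
      from lower[OF this] before[OF this, of j] show ?case
        by (metis exp_le_cancel_iff exp_ln)
    qed
  qed auto
  with Tj show False using exp_gt_zero[of "ln (x0 $ j) - norm_int T"] by linarith
qed

text \<open>Allows a forward and a backward solution to be glued at time 0, since each half ignores
  the other sign of time.\<close>

lemma solution_cong:
  assumes "\<And>t. t \<ge> 0 \<Longrightarrow> x t = y t"
  shows "solution x0 x \<longleftrightarrow> solution x0 y"
proof -
  have "integral {0..t} (\<lambda>s. B s *v x s) = integral {0..t} (\<lambda>s. B s *v y s)" for t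
    by (rule integral_cong) (simp add: assms)
  moreover have "(\<lambda>s. B s *v x s) absolutely_integrable_on {0..t} \<longleftrightarrow>
      (\<lambda>s. B s *v y s) absolutely_integrable_on {0..t}" for t
    by (rule set_integrable_cong) (simp_all add: assms)
  ultimately show ?thesis by (simp add: solution_def assms)
qed

text \<open>Superposition; with \<open>solution_scaleR\<close> and uniqueness it makes the time-t
  map linear.\<close>

lemma solution_add:
  assumes "solution x0 x" "solution y0 y"
  shows "solution (x0 + y0) (\<lambda>t. x t + y t)"
  unfolding solution_def
proof (intro allI impI conjI)
  fix t :: real assume t: "t \<ge> 0"
  have x: "(\<lambda>s. B s *v x s) absolutely_integrable_on {0..t}" "x t = x0 + integral {0..t} (\<lambda>s. B s *v x s)"
    and y: "(\<lambda>s. B s *v y s) absolutely_integrable_on {0..t}" "y t = y0 + integral {0..t} (\<lambda>s. B s *v y s)"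
    using assms t by (auto simp: solution_def)
  show "(\<lambda>s. B s *v (x s + y s)) absolutely_integrable_on {0..t}"
    using set_integral_add(1)[OF x(1) y(1)] by (simp add: matrix_vector_right_distrib)
  show "x t + y t = x0 + y0 + integral {0..t} (\<lambda>s. B s *v (x s + y s))"
    using x y by (simp add: matrix_vector_right_distrib integral_add absolutely_integrable_on_def)
qed

lemma solution_scaleR:
  assumes "solution x0 x"
  shows "solution (c *\<^sub>R x0) (\<lambda>t. c *\<^sub>R x t)"
  unfolding solution_def
proof (intro allI impI conjI)
  fix t :: real assume t: "t \<ge> 0"
  have x: "(\<lambda>s. B s *v x s) absolutely_integrable_on {0..t}" "x t = x0 + integral {0..t} (\<lambda>s. B s *v x s)"
    using assms t by (auto simp: solution_def)
  show "(\<lambda>s. B s *v c *\<^sub>R x s) absolutely_integrable_on {0..t}"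
    using absolutely_integrable_scaleR_left[OF x(1), of c] by (simp add: matrix_vector_mult_scaleR)
  show "c *\<^sub>R x t = c *\<^sub>R x0 + integral {0..t} (\<lambda>s. B s *v c *\<^sub>R x s)"
    using x by (simp add: matrix_vector_mult_scaleR scaleR_add_right)
qed

end

section \<open>Growth of positive solutions\<close>

text \<open>The integrand of the theorem. The linear order on the index type selects each unordered
  pair of distinct indices once.\<close>

definition drift_bound :: "real^('n::{finite,linorder})^('n::{finite,linorder}) \<Rightarrow> real" where
  "drift_bound A = trace A + 2 * (\<Sum>j\<in>UNIV. \<Sum>k\<in>{k. j < k}. sqrt (A $ j $ k * A $ k $ j))"

text \<open>The terms \<open>A $ j $ k * x $ k / x $ j\<close> and
  \<open>A $ k $ j * x $ j / x $ k\<close> have a product in which \<open>x\<close> cancels, so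
  AM-GM bounds their sum below by a quantity free of \<open>x\<close>. The diagonal terms give the
  trace.\<close>

lemma drift_bound_le:
  fixes A :: "real^('n::{finite,linorder})^('n::{finite,linorder})"
  assumes x: "\<And>i. x $ i > 0" and A: "\<And>j k. j \<noteq> k \<Longrightarrow> A $ j $ k \<ge> 0"
  shows "drift_bound A \<le> (\<Sum>i\<in>UNIV. inverse (x $ i) * (A *v x) $ i)"
proof -
  define h where "h i k = A $ i $ k * x $ k / x $ i" for i k
  have amgm: "2 * sqrt (A $ j $ k * A $ k $ j) \<le> h j k + h k j" if "j < k" for j k
  proof -
    have "h j k * h k j = A $ j $ k * A $ k $ j"
      using x[of j] x[of k] by (simp add: h_def)
    moreover have "h j k \<ge> 0" "h k j \<ge> 0"
      using that A[of j k] A[of k j] x[of j] x[of k] by (auto simp: h_def)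
    ultimately show ?thesis
      using arith_geo_mean_sqrt[of "h j k" "h k j"] by simp
  qed
  have row: "inverse (x $ i) * (A *v x) $ i = A $ i $ i + (\<Sum>k\<in>{k. i < k}. h i k) + (\<Sum>k\<in>{k. k < i}. h i k)" for i
  proof -
    have "inverse (x $ i) * (A *v x) $ i = (\<Sum>k\<in>UNIV. h i k)"
      by (simp add: matrix_vector_mult_def h_def sum_distrib_left divide_inverse mult_ac)
    also have "UNIV = insert i ({k. i < k} \<union> {k. k < i})" by auto
    also have "(\<Sum>k\<in>\<dots>. h i k) = h i i + (\<Sum>k\<in>{k. i < k} \<union> {k. k < i}. h i k)"
      by (subst sum.insert) auto
    also have "(\<Sum>k\<in>{k. i < k} \<union> {k. k < i}. h i k) = (\<Sum>k\<in>{k. i < k}. h i k) + (\<Sum>k\<in>{k. k < i}. h i k)"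
      by (rule sum.union_disjoint) auto
    also have "h i i = A $ i $ i" using x[of i] by (simp add: h_def)
    finally show ?thesis by simp
  qed
  \<comment> \<open>Reindexing the lower triangle by pairs j < k brings the two terms of each pair
    under the same sum.\<close>
  have swap: "(\<Sum>i\<in>UNIV. \<Sum>k\<in>{k. k < i}. h i k) = (\<Sum>j\<in>UNIV. \<Sum>k\<in>{k. j < k}. h k j)"
    using sum.swap_restrict[of UNIV UNIV h "\<lambda>i k. k < i"] by simp
  have "drift_bound A = trace A + (\<Sum>j\<in>UNIV. \<Sum>k\<in>{k. j < k}. 2 * sqrt (A $ j $ k * A $ k $ j))"
    by (simp add: drift_bound_def sum_distrib_left)
  also have "\<dots> \<le> trace A + (\<Sum>j\<in>UNIV. \<Sum>k\<in>{k. j < k}. h j k + h k j)"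
    by (intro add_left_mono sum_mono amgm) auto
  also have "\<dots> = (\<Sum>i\<in>UNIV. inverse (x $ i) * (A *v x) $ i)"
    by (simp add: row sum.distrib swap trace_def)
  finally show ?thesis .
qed

text \<open>Every entry, and every geometric mean of two entries, is at most \<open>norm A\<close>
  in absolute value. The crude linear bound turns integrability of the matrix into integrability of
  the drift.\<close>

lemma abs_drift_bound_le:
  fixes A :: "real^('n::{finite,linorder})^('n::{finite,linorder})"
  shows "\<bar>drift_bound A\<bar> \<le> (real CARD('n) + 2 * (real CARD('n) * real CARD('n))) * norm A"
proof -
  have entry: "\<bar>A $ j $ k\<bar> \<le> norm A" for j k
    by (rule order_trans[OF component_le_norm_cart Finite_Cartesian_Product.norm_nth_le])
  have sq: "\<bar>sqrt (A $ j $ k * A $ k $ j)\<bar> \<le> norm A" for j k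
  proof -
    \<comment> \<open>The real \<open>sqrt\<close> is odd, so this holds for products of either
      sign.\<close>
    have "\<bar>sqrt (A $ j $ k * A $ k $ j)\<bar> = sqrt (\<bar>A $ j $ k\<bar> * \<bar>A $ k $ j\<bar>)"
      by (simp add: real_sqrt_abs' real_sqrt_mult abs_mult)
    also have "\<dots> \<le> sqrt (norm A * norm A)"
      by (intro real_sqrt_le_mono mult_mono entry) auto
    finally show ?thesis by simp
  qed
  have "\<bar>trace A\<bar> \<le> (\<Sum>i::'n\<in>UNIV. norm A)"
    unfolding trace_def by (rule order_trans[OF sum_abs sum_mono]) (rule entry)
  moreover have "\<bar>\<Sum>j\<in>UNIV. \<Sum>k\<in>{k. j < k}. sqrt (A $ j $ k * A $ k $ j)\<bar> \<le> (\<Sum>j::'n\<in>UNIV. real CARD('n) * norm A)"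
  proof (rule order_trans[OF sum_abs sum_mono])
    fix j :: 'n
    have "\<bar>\<Sum>k\<in>{k. j < k}. sqrt (A $ j $ k * A $ k $ j)\<bar> \<le> (\<Sum>k\<in>{k. j < k}. norm A)"
      by (rule order_trans[OF sum_abs sum_mono]) (rule sq)
    also have "\<dots> \<le> (\<Sum>k::'n\<in>UNIV. norm A)"
      by (rule sum_mono2) auto
    finally show "\<bar>\<Sum>k\<in>{k. j < k}. sqrt (A $ j $ k * A $ k $ j)\<bar> \<le> real CARD('n) * norm A"
      by simp
  qed
  ultimately show ?thesis
    unfolding drift_bound_def by (simp add: algebra_simps)
qed

lemma borel_measurable_drift_bound [measurable]:
  "(drift_bound :: real^('n::{finite,linorder})^('n::{finite,linorder}) \<Rightarrow> real) \<in> borel_measurable borel"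
proof -
  have "continuous_on UNIV (\<lambda>A::real^('n::{finite,linorder})^('n::{finite,linorder}). drift_bound A)"
    unfolding drift_bound_def trace_def by (intro continuous_intros)
  then show ?thesis by (rule borel_measurable_continuous_onI)
qed

text \<open>Start at the all-ones vector, so the logarithms of the components vanish at time 0.
  Integrating the pointwise bound gives the sum of the logarithms at time t, and each component is
  at most the norm.\<close>

lemma integral_drift_bound_le_ln_norm:
  fixes B :: "real \<Rightarrow> real^('n::{finite,linorder})^('n::{finite,linorder})"
  assumes "linear_ode B"
    and offdiag: "\<And>s j k. s \<ge> 0 \<Longrightarrow> j \<noteq> k \<Longrightarrow> B s $ j $ k \<ge> 0"
    and x: "linear_ode.solution B 1 x" and t: "t \<ge> 0"
    and int: "(\<lambda>s. drift_bound (B s)) integrable_on {0..t}"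
  shows "integral {0..t} (\<lambda>s. drift_bound (B s)) \<le> CARD('n) * ln (norm (x t))" and "norm (x t) > 0"
proof -
  interpret linear_ode B by fact
  have pos: "x s $ i > 0" if "s \<ge> 0" for s i
    using solution_positive[OF x _ offdiag that] by simp
  have x0: "x 0 = 1" using x by (auto simp: solution_def)
  have "((\<lambda>s. inverse (x s $ i) * (B s *v x s) $ i) has_integral ln (x t $ i) - ln (x 0 $ i)) {0..t}" for i
    using pos by (intro ln_component_has_integral[OF x t]) auto
  then have "((\<lambda>s. inverse (x s $ i) * (B s *v x s) $ i) has_integral ln (x t $ i)) {0..t}" for i
    by (simp add: x0)
  then have "((\<lambda>s. \<Sum>i\<in>UNIV. inverse (x s $ i) * (B s *v x s) $ i) has_integral (\<Sum>i\<in>UNIV. ln (x t $ i))) {0..t}"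
    by (intro has_integral_sum) auto
  then have "integral {0..t} (\<lambda>s. drift_bound (B s)) \<le> (\<Sum>i\<in>UNIV. ln (x t $ i))"
    by (rule has_integral_le[OF integrable_integral[OF int]]) (use pos offdiag in \<open>auto intro!: drift_bound_le\<close>)
  also have "\<dots> \<le> (\<Sum>i::'n\<in>UNIV. ln (norm (x t)))"
  proof (rule sum_mono)
    fix i
    have "x t $ i \<le> norm (x t)"
      using component_le_norm_cart[of "x t" i] by linarith
    then show "ln (x t $ i) \<le> ln (norm (x t))"
      using pos[OF t, of i] by (subst ln_le_cancel_iff) linarith+
  qed
  finally show "integral {0..t} (\<lambda>s. drift_bound (B s)) \<le> CARD('n) * ln (norm (x t))" by simp
  show "norm (x t) > 0" using pos[OF t, of undefined] by auto
qed

section \<open>Solutions on the whole real line and the solution operator\<close>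

text \<open>\<open>carath_sol\<close> constrains both directions of time. Reversing time turns the
  negative half into a forward problem with coefficients
  \<open>- A (\<theta> (- s) \<omega>)\<close>, so the half-line theory applies twice.\<close>

locale two_sided_ode =
  fixes \<theta> :: "real \<Rightarrow> 'a \<Rightarrow> 'a" and A :: "'a \<Rightarrow> real^'n^'n" and \<omega> :: 'a
  assumes forward: "linear_ode (\<lambda>s. A (\<theta> s \<omega>))"
    and backward: "linear_ode (\<lambda>s. - A (\<theta> (- s) \<omega>))"
begin

sublocale fwd: linear_ode "\<lambda>s. A (\<theta> s \<omega>)" by (rule forward)
sublocale bwd: linear_ode "\<lambda>s. - A (\<theta> (- s) \<omega>)" by (rule backward)

lemma carath_sol_iff:
  shows "carath_sol \<theta> A \<omega> x0 x \<longleftrightarrow> fwd.solution x0 x \<and>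
    bwd.solution x0 (\<lambda>t. x (- t))"
proof -
  define P where "P t \<longleftrightarrow> (\<lambda>s. A (\<theta> s \<omega>) *v x s) absolutely_integrable_on {min 0 t..max 0 t} \<and>
          x t = x0 + (if 0 \<le> t then integral {0..t} (\<lambda>s. A (\<theta> s \<omega>) *v x s)
                      else - integral {t..0} (\<lambda>s. A (\<theta> s \<omega>) *v x s))" for t
  have neg_mv: "(- C) *v v = - (C *v v)" for C :: "real^'n^'n" and v
    using matrix_vector_mult_diff_rdistrib[of 0 C v] by simp
  have refl_int: "(\<lambda>s. (- A (\<theta> (- s) \<omega>)) *v x (- s)) absolutely_integrable_on {0..t} \<longleftrightarrow>
      (\<lambda>s. A (\<theta> s \<omega>) *v x s) absolutely_integrable_on {- t..0}" for t
    using absolutely_integrable_reflect_real[where f = "\<lambda>s. A (\<theta> s \<omega>) *v x s" and a = "- t" and b = 0]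
    by (simp add: set_integrable_def neg_mv)
  have refl_val: "integral {0..t} (\<lambda>s. (- A (\<theta> (- s) \<omega>)) *v x (- s)) =
      - integral {- t..0} (\<lambda>s. A (\<theta> s \<omega>) *v x s)" for t
    using Henstock_Kurzweil_Integration.integral_reflect_real[where f = "\<lambda>s. A (\<theta> s \<omega>) *v x s" and a = "- t" and b = 0]
    by (simp add: neg_mv)
  have f: "fwd.solution x0 x \<longleftrightarrow> (\<forall>t\<ge>0. P t)"
    unfolding fwd.solution_def P_def by (auto simp: max_def min_def)
  have b: "bwd.solution x0 (\<lambda>t. x (- t)) \<longleftrightarrow> (\<forall>t\<ge>0. P (- t))"
    unfolding bwd.solution_def refl_int refl_val
  proof (intro all_cong)
    fix t :: real assume t: "t \<ge> 0"
    have "{min 0 (- t)..max 0 (- t)} = {- t..0}"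
      using t by simp
    \<comment> \<open>At t = 0 the conditional in \<open>P\<close> takes its nonnegative branch; the
      two sides agree there because integrals over a point vanish.\<close>
    then show "((\<lambda>s. A (\<theta> s \<omega>) *v x s) absolutely_integrable_on {- t..0} \<and>
        x (- t) = x0 + - integral {- t..0} (\<lambda>s. A (\<theta> s \<omega>) *v x s)) \<longleftrightarrow> P (- t)"
      using t by (cases "t = 0") (simp_all add: P_def)
  qed
  have "(\<forall>t. P t) \<longleftrightarrow> (\<forall>t\<ge>0. P t) \<and> (\<forall>t\<ge>0. P (- t))"
  proof (intro iffI conjI allI)
    fix t assume *: "(\<forall>t\<ge>0. P t) \<and> (\<forall>t\<ge>0. P (- t))"
    show "P t"
    proof (cases "t \<ge> 0")
      case False
      then have "P (- (- t))" using * by (intro conjunct2[OF *, rule_format]) simp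
      then show ?thesis by simp
    qed (use * in blast)
  qed blast+
  then show ?thesis
    unfolding f b carath_sol_def P_def .
qed

text \<open>\<open>U_sol\<close> is a definite description, so it is meaningful only after existence
  and uniqueness on the whole line: existence by gluing the two halves, uniqueness from each half
  separately.\<close>

lemma U_sol_solution:
  shows "fwd.solution x0 (\<lambda>t. U_sol \<theta> A \<omega> t x0)"
proof -
  obtain y z where y: "fwd.solution x0 y" and z: "bwd.solution x0 z"
    using fwd.solution_exists bwd.solution_exists by metis
  define x where "x t = (if t \<ge> 0 then y t else z (- t))" for t
  \<comment> \<open>At time 0 the glued function takes its value from \<open>y\<close>, and the
    backward equation needs the value of \<open>z\<close>; both are \<open>x0\<close>.\<close>
  have "y 0 = z 0"
    using y z by (auto simp: fwd.solution_def bwd.solution_def)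
  then have "fwd.solution x0 x" "bwd.solution x0 (\<lambda>t. x (- t))"
    using y z fwd.solution_cong[of x y x0] bwd.solution_cong[of "\<lambda>t. x (- t)" z x0] by (auto simp: x_def)
  then have ex: "carath_sol \<theta> A \<omega> x0 x"
    by (simp add: carath_sol_iff)
  have "x' = x" if "carath_sol \<theta> A \<omega> x0 x'" for x'
  proof
    fix t
    have "x' t = x t" if "t \<ge> 0" for t
      using ex \<open>carath_sol \<theta> A \<omega> x0 x'\<close> fwd.solution_unique that by (auto simp: carath_sol_iff)
    moreover have "x' (- t) = x (- t)" if "t \<ge> 0" for t
      using ex \<open>carath_sol \<theta> A \<omega> x0 x'\<close> bwd.solution_unique that
      unfolding carath_sol_iff by blast
    ultimately show "x' t = x t"
      by (metis linear minus_minus neg_0_le_iff_le)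
  qed
  with ex have "carath_sol \<theta> A \<omega> x0 (THE x. carath_sol \<theta> A \<omega> x0 x)"
    by (rule theI)
  then show ?thesis
    by (simp add: U_sol_def carath_sol_iff)
qed

text \<open>Boundedness, automatic for linear maps in finite dimension, is what lets
  \<open>onorm\<close> control individual vectors.\<close>

lemma bounded_linear_U_sol:
  assumes t: "t \<ge> 0"
  shows "bounded_linear (U_sol \<theta> A \<omega> t)"
proof -
  note U = U_sol_solution
  have "linear (U_sol \<theta> A \<omega> t)"
  proof (rule linearI)
    show "U_sol \<theta> A \<omega> t (a + b) = U_sol \<theta> A \<omega> t a + U_sol \<theta> A \<omega> t b" for a b
      using fwd.solution_unique[OF U fwd.solution_add[OF U U] t] .
    show "U_sol \<theta> A \<omega> t (c *\<^sub>R a) = c *\<^sub>R U_sol \<theta> A \<omega> t a" for c a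
      using fwd.solution_unique[OF U fwd.solution_scaleR[OF U] t] .
  qed
  then show ?thesis by (simp add: linear_conv_bounded_linear)
qed

end

text \<open>The operator norm dominates the solution from the all-ones vector up to the norm of that
  vector. The resulting additive constant does not depend on t and vanishes in the time
  average.\<close>

lemma integral_drift_bound_le_ln_onorm:
  fixes A :: "'a \<Rightarrow> real^('n::{finite,linorder})^('n::{finite,linorder})"
  assumes "two_sided_ode \<theta> A \<omega>"
    and offdiag: "\<And>s j k. j \<noteq> k \<Longrightarrow> A (\<theta> s \<omega>) $ j $ k \<ge> 0" and t: "t \<ge> 0"
    and int: "(\<lambda>s. drift_bound (A (\<theta> s \<omega>))) integrable_on {0..t}"
  shows "integral {0..t} (\<lambda>s. drift_bound (A (\<theta> s \<omega>))) \<le>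
    CARD('n) * (ln (onorm (U_sol \<theta> A \<omega> t)) + ln (norm (1 :: real^('n::{finite,linorder}))))"
proof -
  interpret two_sided_ode \<theta> A \<omega> by fact
  note * = integral_drift_bound_le_ln_norm[OF fwd.linear_ode_axioms offdiag U_sol_solution t int]
  have le: "norm (U_sol \<theta> A \<omega> t 1) \<le> onorm (U_sol \<theta> A \<omega> t) * norm (1 :: real^('n::{finite,linorder}))"
    by (rule onorm[OF bounded_linear_U_sol[OF t]])
  have n1: "norm (1 :: real^('n::{finite,linorder})) > 0" by simp
  have pos: "onorm (U_sol \<theta> A \<omega> t) > 0"
    using le *(2) n1 by (metis less_le_trans zero_less_mult_pos2)
  have "ln (norm (U_sol \<theta> A \<omega> t 1)) \<le> ln (onorm (U_sol \<theta> A \<omega> t) * norm (1 :: real^('n::{finite,linorder})))"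
    using le *(2) pos n1 by (subst ln_le_cancel_iff) (auto intro: mult_pos_pos)
  also have "\<dots> = ln (onorm (U_sol \<theta> A \<omega> t)) + ln (norm (1 :: real^('n::{finite,linorder})))"
    using pos n1 by (rule ln_mult_pos)
  finally have "CARD('n) * ln (norm (U_sol \<theta> A \<omega> t 1)) \<le>
      CARD('n) * (ln (onorm (U_sol \<theta> A \<omega> t)) + ln (norm (1 :: real^('n::{finite,linorder}))))"
    by (intro mult_left_mono) auto
  with *(1) show ?thesis by linarith
qed

section \<open>Time averages along a measure-preserving flow\<close>

text \<open>\<open>ennreal\<close> sends negative values to 0, so the right side is the integral of
  the positive part; the left side also subtracts that of the negative part.\<close>

lemma ennreal_integral_le_nn_integral:
  assumes "integrable M f"
  shows "ennreal (integral\<^sup>L M f) \<le> (\<integral>\<^sup>+x. ennreal (f x) \<partial>M)"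
proof -
  have "ennreal (integral\<^sup>L M f) \<le> ennreal (enn2real (\<integral>\<^sup>+x. ennreal (f x) \<partial>M))"
    by (intro ennreal_leI) (simp add: real_lebesgue_integral_def[OF assms])
  also have "\<dots> \<le> (\<integral>\<^sup>+x. ennreal (f x) \<partial>M)"
    by (simp add: ennreal_enn2real_if)
  finally show ?thesis .
qed

locale measure_preserving_flow = prob_space M for M :: "'a measure" +
  fixes \<theta> :: "real \<Rightarrow> 'a \<Rightarrow> 'a"
  assumes flow: "mp_flow M \<theta>"
begin

sublocale pair: pair_sigma_finite M lborel ..

lemma flow_measurable_pair: "(\<lambda>(\<omega>, t). \<theta> t \<omega>) \<in> M \<Otimes>\<^sub>M lborel \<rightarrow>\<^sub>M M"
proof -
  have "(\<lambda>(t, \<omega>). \<theta> t \<omega>) \<in> borel \<Otimes>\<^sub>M M \<rightarrow>\<^sub>M M"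
    using flow by (simp add: mp_flow_def)
  moreover have "(\<lambda>(\<omega>, t). (t, \<omega>)) \<in> M \<Otimes>\<^sub>M lborel \<rightarrow>\<^sub>M borel \<Otimes>\<^sub>M M"
    by measurable
  ultimately have "(\<lambda>p. case (case p of (\<omega>, t) \<Rightarrow> (t, \<omega>)) of (t, \<omega>) \<Rightarrow> \<theta> t \<omega>) \<in> M \<Otimes>\<^sub>M lborel \<rightarrow>\<^sub>M M"
    by (rule measurable_compose[rotated])
  then show ?thesis by (simp add: case_prod_beta)
qed

lemma flow_measurable: "\<theta> t \<in> M \<rightarrow>\<^sub>M M"
proof -
  have "(\<lambda>\<omega>. (\<omega>, t)) \<in> M \<rightarrow>\<^sub>M M \<Otimes>\<^sub>M lborel"
    by measurable
  from measurable_compose[OF this flow_measurable_pair] show ?thesis by simp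
qed

lemma orbit_measurable: "\<omega> \<in> space M \<Longrightarrow> (\<lambda>t. \<theta> t \<omega>) \<in> borel \<rightarrow>\<^sub>M M"
proof -
  assume "\<omega> \<in> space M"
  then have "Pair \<omega> \<in> lborel \<rightarrow>\<^sub>M M \<Otimes>\<^sub>M lborel" by (rule measurable_Pair1')
  from measurable_compose[OF this flow_measurable_pair]
  show "(\<lambda>t. \<theta> t \<omega>) \<in> borel \<rightarrow>\<^sub>M M" by simp
qed

lemma flow_in_space: "\<omega> \<in> space M \<Longrightarrow> \<theta> t \<omega> \<in> space M"
  by (rule measurable_space[OF flow_measurable])

lemma flow_cancel: "\<omega> \<in> space M \<Longrightarrow> \<theta> (- t) (\<theta> t \<omega>) = \<omega>"
proof -
  assume \<omega>: "\<omega> \<in> space M"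
  then have "\<theta> (t + - t) \<omega> = \<theta> (- t) (\<theta> t \<omega>)" "\<theta> 0 \<omega> = \<omega>"
    using flow unfolding mp_flow_def by blast+
  then show ?thesis by simp
qed

text \<open>\<open>mp_flow\<close> states invariance for images, a push-forward needs preimages: the
  preimage of F under \<open>\<theta> t\<close> is its image under
  \<open>\<theta> (- t)\<close>.\<close>

lemma distr_flow: "distr M M (\<theta> t) = M"
proof (rule measure_eqI)
  fix F assume "F \<in> sets (distr M M (\<theta> t))"
  then have F: "F \<in> sets M" by simp
  then have sub: "F \<subseteq> space M" by (rule sets.sets_into_space)
  have "\<theta> t -` F \<inter> space M = \<theta> (- t) ` F"
  proof (intro subset_antisym subsetI)
    fix \<omega> assume "\<omega> \<in> \<theta> t -` F \<inter> space M"
    then show "\<omega> \<in> \<theta> (- t) ` F" using flow_cancel[of \<omega> t] by force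
  next
    fix \<omega> assume "\<omega> \<in> \<theta> (- t) ` F"
    then obtain \<eta> where "\<eta> \<in> F" "\<omega> = \<theta> (- t) \<eta>" by blast
    then show "\<omega> \<in> \<theta> t -` F \<inter> space M"
      using flow_cancel[of \<eta> "- t"] sub flow_in_space by auto
  qed
  then show "emeasure (distr M M (\<theta> t)) F = emeasure M F"
    using F flow by (simp add: emeasure_distr[OF flow_measurable] mp_flow_def)
qed simp

lemma orbit_integrand_measurable:
  assumes f: "f \<in> borel_measurable M" and S: "S \<in> sets borel"
  shows "(\<lambda>(\<omega>, s). f (\<theta> s \<omega>) * indicator S s :: ennreal) \<in> borel_measurable (M \<Otimes>\<^sub>M lborel)"
proof -
  have [measurable]: "(\<lambda>p. f (\<theta> (snd p) (fst p))) \<in> borel_measurable (M \<Otimes>\<^sub>M lborel)"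
    using measurable_compose[OF flow_measurable_pair f] by (simp add: case_prod_beta)
  note S[measurable]
  show ?thesis unfolding case_prod_beta by measurable
qed

text \<open>Tonelli exchanges the integrals, and invariance makes the inner integral over
  \<open>M\<close> independent of s.\<close>

lemma nn_integral_orbit:
  fixes f :: "'a \<Rightarrow> ennreal"
  assumes f: "f \<in> borel_measurable M" and S: "S \<in> sets borel"
  shows "(\<integral>\<^sup>+\<omega>. \<integral>\<^sup>+s. f (\<theta> s \<omega>) * indicator S s \<partial>lborel \<partial>M) = (\<integral>\<^sup>+\<omega>. f \<omega> \<partial>M) * emeasure lborel S"
proof -
  have "(\<integral>\<^sup>+\<omega>. \<integral>\<^sup>+s. f (\<theta> s \<omega>) * indicator S s \<partial>lborel \<partial>M) =
      (\<integral>\<^sup>+s. \<integral>\<^sup>+\<omega>. f (\<theta> s \<omega>) * indicator S s \<partial>M \<partial>lborel)"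
    using pair.Fubini[OF orbit_integrand_measurable[OF f S]] by simp
  also have "\<dots> = (\<integral>\<^sup>+s. (\<integral>\<^sup>+\<omega>. f \<omega> \<partial>M) * indicator S s \<partial>lborel)"
  proof (rule nn_integral_cong)
    fix s :: real
    have m: "(\<lambda>\<omega>. f (\<theta> s \<omega>)) \<in> borel_measurable M"
      by (rule measurable_compose[OF flow_measurable f])
    have "(\<integral>\<^sup>+\<omega>. f (\<theta> s \<omega>) \<partial>M) = (\<integral>\<^sup>+\<omega>. f \<omega> \<partial>distr M M (\<theta> s))"
      using f by (subst nn_integral_distr) (auto intro: flow_measurable)
    then have "(\<integral>\<^sup>+\<omega>. f (\<theta> s \<omega>) \<partial>M) = (\<integral>\<^sup>+\<omega>. f \<omega> \<partial>M)"
      by (simp add: distr_flow)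
    then show "(\<integral>\<^sup>+\<omega>. f (\<theta> s \<omega>) * indicator S s \<partial>M) = (\<integral>\<^sup>+\<omega>. f \<omega> \<partial>M) * indicator S s"
      using m by (simp add: nn_integral_multc)
  qed
  also have "\<dots> = (\<integral>\<^sup>+\<omega>. f \<omega> \<partial>M) * emeasure lborel S"
    using S by (simp add: nn_integral_cmult_indicator)
  finally show ?thesis .
qed

text \<open>The integral of the norm along the orbit over \<open>{- real n..real n}\<close> has
  finite mean, hence is finite almost everywhere. Countably many n give one null set that serves all
  intervals.\<close>

lemma AE_orbit_absolutely_integrable:
  fixes f :: "'a \<Rightarrow> 'b::euclidean_space"
  assumes f: "integrable M f"
  shows "AE \<omega> in M. \<forall>a b. (\<lambda>s. f (\<theta> s \<omega>)) absolutely_integrable_on {a..b}"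
proof -
  have fm: "f \<in> borel_measurable M" using f by auto
  have nm: "(\<lambda>\<omega>. ennreal (norm (f \<omega>))) \<in> borel_measurable M" using fm by measurable
  have "AE \<omega> in M. (\<integral>\<^sup>+s. ennreal (norm (f (\<theta> s \<omega>))) * indicator {- real n..real n} s \<partial>lborel) \<noteq> \<infinity>" for n
  proof (rule nn_integral_PInf_AE)
    show "(\<lambda>\<omega>. \<integral>\<^sup>+s. ennreal (norm (f (\<theta> s \<omega>))) * indicator {- real n..real n} s \<partial>lborel) \<in> borel_measurable M"
      using lborel.borel_measurable_nn_integral[OF orbit_integrand_measurable[OF nm, of "{- real n..real n}"]]
      by simp
    have "(\<integral>\<^sup>+\<omega>. ennreal (norm (f \<omega>)) \<partial>M) * emeasure lborel {- real n..real n} < \<infinity>"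
      using f by (auto simp: integrable_iff_bounded ennreal_mult_less_top)
    then show "(\<integral>\<^sup>+\<omega>. \<integral>\<^sup>+s. ennreal (norm (f (\<theta> s \<omega>))) * indicator {- real n..real n} s \<partial>lborel \<partial>M) \<noteq> \<infinity>"
      by (simp add: nn_integral_orbit[OF nm])
  qed
  then have "AE \<omega> in M. \<forall>n. (\<integral>\<^sup>+s. ennreal (norm (f (\<theta> s \<omega>))) * indicator {- real n..real n} s \<partial>lborel) \<noteq> \<infinity>"
    by (simp add: AE_all_countable)
  then show ?thesis
  proof (rule AE_mp, intro AE_I2 impI allI)
    fix \<omega> a b assume \<omega>: "\<omega> \<in> space M"
      and fin: "\<forall>n. (\<integral>\<^sup>+s. ennreal (norm (f (\<theta> s \<omega>))) * indicator {- real n..real n} s \<partial>lborel) \<noteq> \<infinity>"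
    obtain n :: nat where n: "max \<bar>a\<bar> \<bar>b\<bar> \<le> real n" using real_arch_simple by blast
    have [measurable]: "(\<lambda>s. f (\<theta> s \<omega>)) \<in> borel_measurable borel"
      by (rule measurable_compose[OF orbit_measurable[OF \<omega>] fm])
    have "set_integrable lborel {- real n..real n} (\<lambda>s. f (\<theta> s \<omega>))"
      unfolding set_integrable_def
    proof (rule integrableI_bounded)
      have "(\<integral>\<^sup>+s. ennreal (norm (indicator {- real n..real n} s *\<^sub>R f (\<theta> s \<omega>))) \<partial>lborel) =
          (\<integral>\<^sup>+s. ennreal (norm (f (\<theta> s \<omega>))) * indicator {- real n..real n} s \<partial>lborel)"
        by (rule nn_integral_cong) (auto split: split_indicator)
      then show "(\<integral>\<^sup>+s. ennreal (norm (indicator {- real n..real n} s *\<^sub>R f (\<theta> s \<omega>))) \<partial>lborel) < \<infinity>"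
        using fin by (simp add: less_top)
    qed measurable
    then have "(\<lambda>s. f (\<theta> s \<omega>)) absolutely_integrable_on {- real n..real n}"
      unfolding set_integrable_def by (subst integrable_completion) auto
    then show "(\<lambda>s. f (\<theta> s \<omega>)) absolutely_integrable_on {a..b}"
      by (rule set_integrable_subset) (use n in auto)
  qed
qed

text \<open>Moves from the gauge integral of the differential equation to a nonnegative integral
  over \<open>lborel\<close>, to which Tonelli applies. Replacing c - g by its positive part costs
  only an inequality in the right direction.\<close>

lemma ennreal_integral_orbit_le:
  fixes g :: "'a \<Rightarrow> real"
  assumes g: "g \<in> borel_measurable M" and \<omega>: "\<omega> \<in> space M"
    and int: "(\<lambda>s. g (\<theta> s \<omega>)) absolutely_integrable_on {0..t}" and t: "t \<ge> 0"
  shows "ennreal (c * t - integral {0..t} (\<lambda>s. g (\<theta> s \<omega>))) \<le>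
    (\<integral>\<^sup>+s. ennreal (c - g (\<theta> s \<omega>)) * indicator {0..t} s \<partial>lborel)"
proof -
  have [measurable]: "(\<lambda>s. g (\<theta> s \<omega>)) \<in> borel_measurable borel"
    by (rule measurable_compose[OF orbit_measurable[OF \<omega>] g])
  define \<phi> where "\<phi> s = indicator {0..t} s *\<^sub>R (c - g (\<theta> s \<omega>))" for s
  have \<phi>m: "\<phi> \<in> borel_measurable lborel"
    unfolding \<phi>_def by measurable
  have ai: "(\<lambda>s. c - g (\<theta> s \<omega>)) absolutely_integrable_on {0..t}"
    using int by (intro set_integral_diff(1)) (auto simp: absolutely_integrable_on_def)
  then have "integrable lebesgue \<phi>"
    unfolding set_integrable_def \<phi>_def[abs_def] .
  then have i: "integrable lborel \<phi>"
    using \<phi>m by (simp add: integrable_completion)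
  have "integral\<^sup>L lborel \<phi> = integral\<^sup>L lebesgue \<phi>"
    using \<phi>m by (simp add: integral_completion)
  also have "\<dots> = integral {0..t} (\<lambda>s. c - g (\<theta> s \<omega>))"
    using set_lebesgue_integral_eq_integral(2)[OF ai] by (simp add: set_lebesgue_integral_def \<phi>_def[abs_def])
  also have "\<dots> = c * t - integral {0..t} (\<lambda>s. g (\<theta> s \<omega>))"
    using int t by (subst Henstock_Kurzweil_Integration.integral_diff) (auto simp: absolutely_integrable_on_def)
  finally have "ennreal (c * t - integral {0..t} (\<lambda>s. g (\<theta> s \<omega>))) \<le> (\<integral>\<^sup>+s. ennreal (\<phi> s) \<partial>lborel)"
    using ennreal_integral_le_nn_integral[OF i] by simp
  also have "\<dots> = (\<integral>\<^sup>+s. ennreal (c - g (\<theta> s \<omega>)) * indicator {0..t} s \<partial>lborel)"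
    by (rule nn_integral_cong) (auto simp: \<phi>_def split: split_indicator)
  finally show ?thesis .
qed

text \<open>For each c, the time averages of the positive part of c - g all have the same mean,
  while their pointwise liminf is at least c - l. Fatou bounds c - l by that mean; taking c = k
  bounds the integral of min k g by l, and k tends to infinity.\<close>

lemma integral_le_of_orbit_averages:
  fixes g :: "'a \<Rightarrow> real" and L :: "nat \<Rightarrow> 'a \<Rightarrow> real"
  assumes g: "integrable M g"
    and lim: "AE \<omega> in M. (\<lambda>n. L n \<omega>) \<longlonglongrightarrow> l"
    and bound: "AE \<omega> in M. \<forall>n. integral {0..real (Suc n)} (\<lambda>s. g (\<theta> s \<omega>)) \<le> real (Suc n) * L n \<omega>"
  shows "integral\<^sup>L M g \<le> l"
proof -
  have gm [measurable]: "g \<in> borel_measurable M" using g by auto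
  have trunc: "ennreal (c - l) \<le> (\<integral>\<^sup>+\<omega>. ennreal (c - g \<omega>) \<partial>M)" for c
  proof -
    have cm: "(\<lambda>\<omega>. ennreal (c - g \<omega>)) \<in> borel_measurable M" by measurable
    define H where "H n \<omega> = (\<integral>\<^sup>+s. ennreal (c - g (\<theta> s \<omega>)) * indicator {0..real (Suc n)} s \<partial>lborel)" for n \<omega>
    have Hm: "H n \<in> borel_measurable M" for n
      using lborel.borel_measurable_nn_integral[OF orbit_integrand_measurable[OF cm, of "{0..real (Suc n)}"]]
      by (simp add: H_def[abs_def])
    define u where "u n \<omega> = ennreal (1 / real (Suc n)) * H n \<omega>" for n \<omega>
    have um: "u n \<in> borel_measurable M" for n
      unfolding u_def using Hm by measurable
    \<comment> \<open>The mean does not depend on n, so the liminf on the right of Fatou's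
      inequality is that of a constant sequence.\<close>
    have int_u: "(\<integral>\<^sup>+\<omega>. u n \<omega> \<partial>M) = (\<integral>\<^sup>+\<omega>. ennreal (c - g \<omega>) \<partial>M)" for n
    proof -
      have "(\<integral>\<^sup>+\<omega>. u n \<omega> \<partial>M) = ennreal (1 / real (Suc n)) * (\<integral>\<^sup>+\<omega>. H n \<omega> \<partial>M)"
        unfolding u_def by (rule nn_integral_cmult[OF Hm])
      also have "(\<integral>\<^sup>+\<omega>. H n \<omega> \<partial>M) = (\<integral>\<^sup>+\<omega>. ennreal (c - g \<omega>) \<partial>M) * ennreal (real (Suc n))"
        unfolding H_def by (subst nn_integral_orbit[OF cm]) auto
      also have "ennreal (1 / real (Suc n)) * \<dots> =
          (\<integral>\<^sup>+\<omega>. ennreal (c - g \<omega>) \<partial>M) * (ennreal (1 / real (Suc n)) * ennreal (real (Suc n)))"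
        by (simp only: mult_ac)
      also have "ennreal (1 / real (Suc n)) * ennreal (real (Suc n)) = 1"
        by (subst ennreal_mult[symmetric]) auto
      finally show ?thesis by simp
    qed
    have "AE \<omega> in M. ennreal (c - l) \<le> liminf (\<lambda>n. u n \<omega>)"
      using lim bound AE_orbit_absolutely_integrable[OF g] AE_space
    proof eventually_elim
      case (elim \<omega>)
      have "ennreal (c - L n \<omega>) \<le> u n \<omega>" for n
      proof -
        have "ennreal (c - L n \<omega>) = ennreal (1 / real (Suc n)) * ennreal (real (Suc n) * (c - L n \<omega>))"
          by (subst ennreal_mult'[symmetric]) auto
        also have "ennreal (real (Suc n) * (c - L n \<omega>)) \<le>
            ennreal (c * real (Suc n) - integral {0..real (Suc n)} (\<lambda>s. g (\<theta> s \<omega>)))"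
          using elim(2) by (intro ennreal_leI) (simp add: algebra_simps)
        also have "\<dots> \<le> H n \<omega>"
          unfolding H_def using elim by (intro ennreal_integral_orbit_le) auto
        finally show ?thesis
          unfolding u_def by (simp add: mult_left_mono)
      qed
      then have "liminf (\<lambda>n. ennreal (c - L n \<omega>)) \<le> liminf (\<lambda>n. u n \<omega>)"
        by (intro Liminf_mono) auto
      moreover have "(\<lambda>n. ennreal (c - L n \<omega>)) \<longlonglongrightarrow> ennreal (c - l)"
        using elim(1) by (intro tendsto_intros)
      ultimately show ?case
        using lim_imp_Liminf[of sequentially "\<lambda>n. ennreal (c - L n \<omega>)"] by simp
    qed
    then have "(\<integral>\<^sup>+\<omega>. ennreal (c - l) \<partial>M) \<le> (\<integral>\<^sup>+\<omega>. liminf (\<lambda>n. u n \<omega>) \<partial>M)"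
      by (rule nn_integral_mono_AE)
    also have "\<dots> \<le> liminf (\<lambda>n. \<integral>\<^sup>+\<omega>. u n \<omega> \<partial>M)"
      by (rule nn_integral_liminf[OF um])
    also have "\<dots> = (\<integral>\<^sup>+\<omega>. ennreal (c - g \<omega>) \<partial>M)"
      by (simp add: int_u Liminf_const)
    finally show ?thesis by (simp add: emeasure_space_1)
  qed
  have "integral\<^sup>L M (\<lambda>\<omega>. min (real k) (g \<omega>)) \<le> l" for k :: nat
  proof -
    have i: "integrable M (\<lambda>\<omega>. max 0 (real k - g \<omega>))"
      using g by (intro integrable_max) auto
    have "ennreal (real k - l) \<le> (\<integral>\<^sup>+\<omega>. ennreal (max 0 (real k - g \<omega>)) \<partial>M)"
      using trunc[of "real k"] by (simp add: ennreal_max_0)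
    also have "\<dots> = ennreal (integral\<^sup>L M (\<lambda>\<omega>. max 0 (real k - g \<omega>)))"
      using i by (intro nn_integral_eq_integral) auto
    finally have "real k - l \<le> integral\<^sup>L M (\<lambda>\<omega>. max 0 (real k - g \<omega>))"
      by (rule ennreal_le_iff[THEN iffD1, rotated]) (auto intro!: Bochner_Integration.integral_nonneg)
    \<comment> \<open>The identity min k g = k - max 0 (k - g) makes the constant k cancel against
      the one in the Fatou bound.\<close>
    moreover have "integral\<^sup>L M (\<lambda>\<omega>. min (real k) (g \<omega>)) = integral\<^sup>L M (\<lambda>\<omega>. real k - max 0 (real k - g \<omega>))"
      by (rule Bochner_Integration.integral_cong) auto
    moreover have "\<dots> = real k - integral\<^sup>L M (\<lambda>\<omega>. max 0 (real k - g \<omega>))"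
      using i by (subst Bochner_Integration.integral_diff) (auto simp: prob_space)
    ultimately show ?thesis by linarith
  qed
  moreover have "(\<lambda>k. integral\<^sup>L M (\<lambda>\<omega>. min (real k) (g \<omega>))) \<longlonglongrightarrow> integral\<^sup>L M g"
  proof (rule integral_dominated_convergence[where w = "\<lambda>\<omega>. \<bar>g \<omega>\<bar>"])
    show "AE \<omega> in M. (\<lambda>k. min (real k) (g \<omega>)) \<longlonglongrightarrow> g \<omega>"
    proof (rule AE_I2)
      fix \<omega>
      obtain k0 :: nat where "g \<omega> \<le> real k0" using real_arch_simple by blast
      then have "eventually (\<lambda>k. min (real k) (g \<omega>) = g \<omega>) sequentially"
        by (intro eventually_sequentiallyI[of k0]) (auto simp: min_def)
      then show "(\<lambda>k. min (real k) (g \<omega>)) \<longlonglongrightarrow> g \<omega>" by (rule tendsto_eventually)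
    qed
  qed (use g in \<open>auto simp: min_def\<close>)
  ultimately show ?thesis by (intro LIMSEQ_le_const2) auto
qed

end

section \<open>The lower bound for the top Lyapunov exponent\<close>

theorem theorem1p1:
  fixes M :: "'a measure" and \<theta> :: "real \<Rightarrow> 'a \<Rightarrow> 'a"
    and A :: "'a \<Rightarrow> real^('n::{finite,linorder})^('n::{finite,linorder})" and lam :: real
  assumes "prob_space M" and "complete_measure M"
    and "mp_flow M \<theta>" and "ergodic_flow M \<theta>"
    and "integrable M A"
    and "\<And>\<omega> j k. \<omega> \<in> space M \<Longrightarrow> j \<noteq> k \<Longrightarrow> A \<omega> $ j $ k \<ge> 0"
    and "top_lyapunov M \<theta> A lam"
  shows "lam \<ge> (1 / real CARD('n)) *
           (\<integral>\<omega>. trace (A \<omega>) + 2 * (\<Sum>j\<in>UNIV. \<Sum>k\<in>{k. j < k}.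
                 sqrt (A \<omega> $ j $ k * A \<omega> $ k $ j)) \<partial>M)"
proof -
  interpret measure_preserving_flow M \<theta>
    by (intro measure_preserving_flow.intro measure_preserving_flow_axioms.intro assms)
  define g where "g \<omega> = drift_bound (A \<omega>)" for \<omega>
  define c where "c = ln (norm (1 :: real^('n::{finite,linorder})))"
  \<comment> \<open>Time is sampled at n + 1 so that the divisor is never 0; the term with
    \<open>c\<close> tends to 0.\<close>
  define L where "L n \<omega> = CARD('n) * (ln (onorm (U_sol \<theta> A \<omega> (real (Suc n)))) / real (Suc n) + c / real (Suc n))" for n \<omega>
  have Am [measurable]: "A \<in> borel_measurable M" using assms(5) by auto
  have g: "integrable M g"
  proof (rule Bochner_Integration.integrable_bound)
    show "integrable M (\<lambda>\<omega>. (real CARD('n) + 2 * (real CARD('n) * real CARD('n))) * norm (A \<omega>))"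
      using assms(5) by auto
    show "g \<in> borel_measurable M" unfolding g_def by measurable
    show "AE \<omega> in M. norm (g \<omega>) \<le> norm ((real CARD('n) + 2 * (real CARD('n) * real CARD('n))) * norm (A \<omega>))"
      using abs_drift_bound_le by (auto simp: g_def)
  qed
  have "integral\<^sup>L M g \<le> CARD('n) * lam"
  proof (rule integral_le_of_orbit_averages[OF g])
    have "AE \<omega> in M. ((\<lambda>t. ln (onorm (U_sol \<theta> A \<omega> t)) / t) \<longlongrightarrow> lam) at_top"
      using assms(7) by (simp add: top_lyapunov_def)
    then show "AE \<omega> in M. (\<lambda>n. L n \<omega>) \<longlonglongrightarrow> CARD('n) * lam"
    proof eventually_elim
      case (elim \<omega>)
      have sq: "filterlim (\<lambda>n. real (Suc n)) at_top sequentially"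
        by (rule filterlim_compose[OF filterlim_real_sequentially filterlim_Suc])
      have "(\<lambda>n. c / real (Suc n)) \<longlonglongrightarrow> 0"
        by (rule real_tendsto_divide_at_top[OF tendsto_const sq])
      from tendsto_mult[OF tendsto_const[of "real CARD('n)"] tendsto_add[OF filterlim_compose[OF elim sq] this]]
      show ?case by (simp add: L_def)
    qed
    \<comment> \<open>Integrability of the matrix along the orbit makes the equation uniquely
      solvable there; that of \<open>g\<close> gives meaning to its time integral.\<close>
    show "AE \<omega> in M. \<forall>n. integral {0..real (Suc n)} (\<lambda>s. g (\<theta> s \<omega>)) \<le> real (Suc n) * L n \<omega>"
      using AE_orbit_absolutely_integrable[OF assms(5)] AE_orbit_absolutely_integrable[OF g] AE_space
    proof (eventually_elim, intro allI)
      fix \<omega> n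
      assume A: "\<forall>a b. (\<lambda>s. A (\<theta> s \<omega>)) absolutely_integrable_on {a..b}"
        and gi: "\<forall>a b. (\<lambda>s. g (\<theta> s \<omega>)) absolutely_integrable_on {a..b}" and \<omega>: "\<omega> \<in> space M"
      \<comment> \<open>Reflecting the negative half of the orbit supplies the coefficients of the
        backward problem.\<close>
      have "(\<lambda>s. A (\<theta> (- s) \<omega>)) absolutely_integrable_on {0..T}" for T
        using A absolutely_integrable_reflect_real[where f = "\<lambda>s. A (\<theta> s \<omega>)" and a = "- T" and b = 0] by simp
      then have ode: "two_sided_ode \<theta> A \<omega>"
        using A by (simp add: two_sided_ode_def linear_ode_def set_integrable_def)
      have "integral {0..real (Suc n)} (\<lambda>s. g (\<theta> s \<omega>)) \<le>
          CARD('n) * (ln (onorm (U_sol \<theta> A \<omega> (real (Suc n)))) + c)"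
        unfolding g_def c_def
        by (rule integral_drift_bound_le_ln_onorm[OF ode])
          (use assms(6) flow_in_space[OF \<omega>] gi in \<open>auto simp: absolutely_integrable_on_def g_def\<close>)
      also have "\<dots> = real (Suc n) * L n \<omega>"
        by (simp add: L_def add_divide_distrib[symmetric] del: of_nat_Suc)
      finally show "integral {0..real (Suc n)} (\<lambda>s. g (\<theta> s \<omega>)) \<le> real (Suc n) * L n \<omega>" .
    qed
  qed
  then show ?thesis
    by (simp add: g_def[abs_def] drift_bound_def field_simps)
qed

end
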